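(* Let $R$ be an integral domain and let $(G,\alpha)$ be an edge-labeled graph. If $G$ contains at least two vertices, then $R_G$ contains a nontrivial generalized spline.
   Context: All graphs are finite, with no multiple edges, and edges join distinct vertices. An edge-labeling function on a graph $G=(V,E)$ is a map $\alpha$ from $E$ to the nonzero ideals of the commutative ring $R$. The generalized splines are $R_G=\{\mathbf{p}\in\bigoplus_{v\in V}R : \mathbf{p}_u-\mathbf{p}_v\in\alpha(uv)\text{ for every edge }uv\in E\}$. A generalized spline is nontrivial if it is not in $R\mathbf{1}$, where $\mathbf{1}_v=1$ for all $v\in V$. *)

theory Defs
  imports "HOL-Algebra.Ring" "HOL-Algebra.Ideal" "HOL-Library.FuncSet"
begin

text \<open>
  A finite graph without loops and multiple edges: an edge is the two-element set of its end vertices.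
\<close>
locale fin_simple_graph =
  fixes V :: "'v set" and E :: "'v set set"
  assumes finite_vertices: "finite V"
    and edges_wf: "e \<in> E \<Longrightarrow> e \<subseteq> V \<and> card e = 2"

text \<open>
  The values of the labeling function outside \<open>E\<close> are irrelevant.
\<close>
locale edge_labeled_graph = fin_simple_graph V E + cring R
  for V :: "'v set" and E :: "'v set set" and R :: "('a, 'b) ring_scheme" (structure) +
  fixes \<alpha> :: "'v set \<Rightarrow> 'a set"
  assumes label_ideal: "e \<in> E \<Longrightarrow> ideal (\<alpha> e) R"
    and label_nonzero: "e \<in> E \<Longrightarrow> \<alpha> e \<noteq> {\<zero>}"

text \<open>
  As \<open>V\<close> is finite, the direct sum of copies of \<open>R\<close> indexed by \<open>V\<close> consists of all families
  \<open>V \<rightarrow>\<^sub>E carrier R\<close>; extensionality (the value \<open>undefined\<close> off \<open>V\<close>) makes each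
  family a unique function.
\<close>
definition splines ::
    "('a, 'b) ring_scheme \<Rightarrow> 'v set \<Rightarrow> 'v set set \<Rightarrow> ('v set \<Rightarrow> 'a set) \<Rightarrow> ('v \<Rightarrow> 'a) set"
  where "splines R V E \<alpha> =
    {p \<in> V \<rightarrow>\<^sub>E carrier R. \<forall>u v. {u, v} \<in> E \<longrightarrow> p u \<ominus>\<^bsub>R\<^esub> p v \<in> \<alpha> {u, v}}"

definition one_spline :: "('a, 'b) ring_scheme \<Rightarrow> 'v set \<Rightarrow> 'v \<Rightarrow> 'a"
  where "one_spline R V = (\<lambda>v\<in>V. \<one>\<^bsub>R\<^esub>)"

definition trivial_splines :: "('a, 'b) ring_scheme \<Rightarrow> 'v set \<Rightarrow> ('v \<Rightarrow> 'a) set"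
  where "trivial_splines R V =
    {(\<lambda>v\<in>V. r \<otimes>\<^bsub>R\<^esub> one_spline R V v) | r. r \<in> carrier R}"

definition nontrivial_spline ::
    "('a, 'b) ring_scheme \<Rightarrow> 'v set \<Rightarrow> 'v set set \<Rightarrow> ('v set \<Rightarrow> 'a set) \<Rightarrow> ('v \<Rightarrow> 'a) \<Rightarrow> bool"
  where "nontrivial_spline R V E \<alpha> p \<longleftrightarrow> p \<in> splines R V E \<alpha> \<and> p \<notin> trivial_splines R V"

end

theory Submission
  imports Defs
begin

text \<open>In a domain, finitely many nonzero ideals have a common nonzero element: the product of
  one nonzero element from each lies in all of them and is not zero. Apply this
  (\<open>nonzero_common_element\<close>) to the labels of the finitely many edges to get
  \<open>c\<close>. The family that is \<open>c\<close> at one vertex and zero at all others is then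
  a spline, since all its values lie in every label. It is not constant because a second vertex
  exists, whereas the multiples of the unit spline are constant.\<close>

lemma (in domain) nonzero_common_element:
  assumes "finite S"
    and "\<And>I. I \<in> S \<Longrightarrow> ideal I R" and "\<And>I. I \<in> S \<Longrightarrow> I \<noteq> {\<zero>}"
  shows "\<exists>c \<in> carrier R - {\<zero>}. \<forall>I \<in> S. c \<in> I"
  using assms
proof (induction S rule: finite_induct)
  case empty
  then show ?case using one_not_zero by blast
next
  case (insert I S)
  then obtain c where c: "c \<in> carrier R" "c \<noteq> \<zero>" "\<forall>J \<in> S. c \<in> J"
    by auto
  interpret I: ideal I R using insert.prems by simp
  have "I \<noteq> {\<zero>}" using insert.prems by simp
  then obtain d where d: "d \<in> I" "d \<noteq> \<zero>" using I.zero_closed by blast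
  \<comment> \<open>The absence of zero divisors keeps the product nonzero; the factor
    \<open>d\<close> puts it in \<open>I\<close>, the factor \<open>c\<close> in every ideal of
    \<open>S\<close>.\<close>
  have "c \<otimes> d \<noteq> \<zero>" using c d integral_iff I.Icarr by simp
  moreover have "c \<otimes> d \<in> I" using c d I.I_l_closed by simp
  moreover have "c \<otimes> d \<in> J" if "J \<in> S" for J
    using that c d I.Icarr insert.prems(1) by (auto intro: ideal.I_r_closed)
  ultimately show ?case using c d I.Icarr by auto
qed

theorem corollary5p6:
  fixes R :: "('a, 'b) ring_scheme"
    and V :: "'v set" and E :: "'v set set" and \<alpha> :: "'v set \<Rightarrow> 'a set"
  assumes "domain R"
    and "edge_labeled_graph V E R \<alpha>"
    and "card V \<ge> 2"
  shows "\<exists>p. nontrivial_spline R V E \<alpha> p"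
proof -
  interpret domain R by fact
  interpret edge_labeled_graph V E R \<alpha> by fact
  have "finite E"
    using edges_wf finite_vertices by (auto intro: finite_subset[of E "Pow V"])
  then have "\<exists>c \<in> carrier R - {\<zero>\<^bsub>R\<^esub>}. \<forall>I \<in> \<alpha> ` E. c \<in> I"
    by (intro nonzero_common_element) (use label_ideal label_nonzero in auto)
  then obtain c where c: "c \<in> carrier R" "c \<noteq> \<zero>\<^bsub>R\<^esub>" "\<And>e. e \<in> E \<Longrightarrow> c \<in> \<alpha> e"
    by auto
  obtain a b where ab: "a \<in> V" "b \<in> V" "a \<noteq> b"
    using assms(3) card_le_Suc0_iff_eq[OF finite_vertices] by force
  define p where "p = (\<lambda>v\<in>V. if v = a then c else \<zero>\<^bsub>R\<^esub>)"
  \<comment> \<open>Each of the two values is \<open>c\<close> or zero, hence already in the label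
    by itself; which end, if any, is \<open>a\<close> does not matter.\<close>
  have "p u \<ominus>\<^bsub>R\<^esub> p v \<in> \<alpha> {u, v}" if e: "{u, v} \<in> E" for u v
  proof -
    interpret I: ideal "\<alpha> {u, v}" R using e by (rule label_ideal)
    have "u \<in> V" "v \<in> V" using edges_wf[OF e] by auto
    then have "p u \<in> \<alpha> {u, v}" "p v \<in> \<alpha> {u, v}" using c(3)[OF e] by (auto simp: p_def)
    then show ?thesis by (simp add: a_minus_def)
  qed
  then have "p \<in> splines R V E \<alpha>" using c by (auto simp: splines_def p_def)
  moreover have "p \<notin> trivial_splines R V"
  proof
    assume "p \<in> trivial_splines R V"
    then obtain r where "r \<in> carrier R" "p = (\<lambda>v\<in>V. r \<otimes>\<^bsub>R\<^esub> one_spline R V v)"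
      by (auto simp: trivial_splines_def)
    \<comment> \<open>A trivial spline is constant on \<open>V\<close>, but \<open>p\<close> takes
      the values \<open>c\<close> at \<open>a\<close> and zero at \<open>b\<close>, and
      \<open>c\<close> is nonzero.\<close>
    then have "p a = r" "p b = r" using ab by (auto simp: one_spline_def)
    then show False using ab c by (simp add: p_def)
  qed
  ultimately show ?thesis by (auto simp: nontrivial_spline_def)
qed

end
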